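(* Let $t_j=j\tau$. If $p\le k$, then the MRMS($k$,$p$) method inherits zero-stability from the underlying $p$-step BDF method; that is, if the underlying $p$-step BDF method is zero-stable, then the MRMS($k$,$p$) method is zero-stable.
   Context: Consider the system of ODEs $y'=f(t,y)$, $y(t)\in\mathbb{R}^n$, with fixed step size $\tau>0$ and grid points $t_j=j\tau$. Underlying BDF formula: for integers $1\le p\le k$ let $c_k,c_{k-1},\dots,c_{k-p}$ be the coefficients of the standard backward differentiation approximation of order $p$, $\tau y'(t_k)\approx c_k y(t_k)+c_{k-1}y(t_{k-1})+\dots+c_{k-p}y(t_{k-p})$ (on the uniform grid they are the unique constants making this exact for all polynomials $y$ of degree at most $p$). The $p$-step BDF formula is $c_ky_k+c_{k-1}y_{k-1}+\dots+c_{k-p}y_{k-p}=\tau f(t_k,y_k)$, with residual function $$r(x)=\tau f(t_k,x)-(c_kx+c_{k-1}y_{k-1}+\dots+c_{k-p}y_{k-p}),\qquad x\in\mathbb{R}^n.$$ MRMS($k$,$p$) method: given $k$ starting points $(t_j,y_j)$, $j=0,\dots,k-1$, put $f_j=f(t_j,y_j)$ and let $\mathcal{V}\subset\mathbb{R}^n$ be the linear span of $y_0,\dots,y_{k-1},\tau f_0,\dots,\tau f_{k-1}$. The method defines $y_k=\operatorname{argmin}_{x\in\mathcal{V}}\|r(x)\|$, where $\|\cdot\|$ is a fixed norm on $\mathbb{R}^n$. Equivalently, $y_k=\sum_{j=0}^{k-1}(\tau\beta_jf_j-\alpha_jy_j)$ with real coefficients $\alpha_j,\beta_j$ chosen on each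 step to minimize $\|r(y_k)\|$. Subsequent values $y_{k+1},y_{k+2},\dots$ are obtained by applying the same step to the last $k$ computed values. Zero-stability concerns the case $f\equiv0$. A method is zero-stable if there is a constant $C$ such that, for $f\equiv0$, every sequence $(y_m)_{m\ge0}$ in $\mathbb{R}^n$ produced by the method satisfies $\|y_m\|\le C\max_j\|y_j\|$ for all $m\ge 0$, the maximum being over the starting values. For the $p$-step BDF method this is equivalent to the root condition: all zeros of its generating polynomial $\rho^{\mathrm{BDF}}(z)=\sum_{i=0}^{p}c_{k-p+i}z^i$ satisfy $|z|\le1$, and those with $|z|=1$ are simple. *)

theory Defs
  imports "HOL-Analysis.Analysis" "HOL-Computational_Algebra.Polynomial"
begin

definition is_norm :: "('a::real_vector \<Rightarrow> real) \<Rightarrow> bool" where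
  "is_norm N \<longleftrightarrow>
     (\<forall>x. 0 \<le> N x) \<and> (\<forall>x. N x = 0 \<longleftrightarrow> x = 0) \<and>
     (\<forall>a x. N (a *\<^sub>R x) = \<bar>a\<bar> * N x) \<and> (\<forall>x y. N (x + y) \<le> N x + N y)"

abbreviation grid :: "real \<Rightarrow> nat \<Rightarrow> real" where
  "grid \<tau> j \<equiv> real j * \<tau>"

definition bdf_exact :: "real \<Rightarrow> nat \<Rightarrow> nat \<Rightarrow> (nat \<Rightarrow> real) \<Rightarrow> bool" where
  "bdf_exact \<tau> k p c \<longleftrightarrow>
     (\<forall>q :: real poly. degree q \<le> p \<longrightarrow>
        \<tau> * poly (pderiv q) (grid \<tau> k) = (\<Sum>j=k-p..k. c j * poly q (grid \<tau> j)))"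

text \<open>The value outside the stencil is fixed to 0 only so that the description is
  definite; see \<open>bdf_coeff_unique\<close> below.\<close>

definition bdf_coeff :: "real \<Rightarrow> nat \<Rightarrow> nat \<Rightarrow> nat \<Rightarrow> real" where
  "bdf_coeff \<tau> k p = (THE c. bdf_exact \<tau> k p c \<and> (\<forall>j. j \<notin> {k-p..k} \<longrightarrow> c j = 0))"

lemma bdf_coeff_unique:
  assumes "\<tau> > 0" and "p \<le> k"
  shows "\<exists>!c. bdf_exact \<tau> k p c \<and> (\<forall>j. j \<notin> {k-p..k} \<longrightarrow> c j = 0)"
proof -
  let ?A = "{k-p..k}"
  have cardA: "card ?A = Suc p" using assms(2) by simp
  have inj: "grid \<tau> i = grid \<tau> j \<longleftrightarrow> i = j" for i j using assms(1) by simp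
  define L where "L j = smult (1 / (\<Prod>i\<in>?A-{j}. grid \<tau> j - grid \<tau> i))
      (\<Prod>i\<in>?A-{j}. [:- grid \<tau> i, 1:])" for j
  have L_val: "poly (L j) (grid \<tau> i) = (if i = j then 1 else 0)" if "i \<in> ?A" "j \<in> ?A" for i j
  proof (cases "i = j")
    case True
    have "(\<Prod>i\<in>?A-{j}. grid \<tau> j - grid \<tau> i) \<noteq> 0"
      using assms(1) by auto
    then show ?thesis using True by (simp add: L_def poly_prod)
  next
    case False
    have "(\<Prod>l\<in>?A-{j}. grid \<tau> i - grid \<tau> l) = 0"
      by (rule prod_zero) (use that False in auto)
    then show ?thesis using False by (simp add: L_def poly_prod)
  qed
  have L_deg: "degree (L j) \<le> p" if "j \<in> ?A" for j
  proof -
    have "degree (\<Prod>i\<in>?A-{j}. [:- grid \<tau> i, 1:]) \<le> (\<Sum>i\<in>?A-{j}. degree [:- grid \<tau> i, 1:])"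
      by (rule order_trans[OF degree_prod_sum_le]) (auto simp: o_def)
    also have "\<dots> = p" using that cardA by (simp add: card_Diff_singleton)
    finally show ?thesis by (simp add: L_def)
  qed
  have interp: "q = (\<Sum>j\<in>?A. smult (poly q (grid \<tau> j)) (L j))" if "degree q \<le> p" for q
  proof (rule poly_eqI_degree[where A = "grid \<tau> ` ?A"])
    have *: "card (grid \<tau> ` ?A) = Suc p"
      by (subst card_image) (use assms cardA in \<open>auto simp: inj_on_def\<close>)
    show "degree q < card (grid \<tau> ` ?A)" using that * by simp
    have "degree (\<Sum>j\<in>?A. smult (poly q (grid \<tau> j)) (L j)) \<le> p"
      by (rule degree_sum_le) (auto intro!: order_trans[OF degree_smult_le] L_deg)
    then show "degree (\<Sum>j\<in>?A. smult (poly q (grid \<tau> j)) (L j)) < card (grid \<tau> ` ?A)"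
      using * by simp
    fix x assume "x \<in> grid \<tau> ` ?A"
    then obtain i where i: "i \<in> ?A" "x = grid \<tau> i" by blast
    have "poly (\<Sum>j\<in>?A. smult (poly q (grid \<tau> j)) (L j)) x =
        (\<Sum>j\<in>?A. if i = j then poly q (grid \<tau> j) else 0)"
      unfolding poly_sum i(2) by (rule sum.cong) (use i(1) L_val in auto)
    also have "\<dots> = poly q x" using i by simp
    finally show "poly q x = poly (\<Sum>j\<in>?A. smult (poly q (grid \<tau> j)) (L j)) x" by simp
  qed
  define c where "c j = (if j \<in> ?A then \<tau> * poly (pderiv (L j)) (grid \<tau> k) else 0)" for j
  have c: "bdf_exact \<tau> k p c"
    unfolding bdf_exact_def
  proof (intro allI impI)
    fix q :: "real poly" assume "degree q \<le> p"
    then have q: "q = (\<Sum>j\<in>?A. smult (poly q (grid \<tau> j)) (L j))" by (rule interp)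
    have "pderiv q = (\<Sum>j\<in>?A. smult (poly q (grid \<tau> j)) (pderiv (L j)))"
      by (subst q) (simp add: higher_pderiv_sum[where n = 1, simplified] pderiv_smult)
    then show "\<tau> * poly (pderiv q) (grid \<tau> k) = (\<Sum>j=k-p..k. c j * poly q (grid \<tau> j))"
      by (simp add: poly_sum sum_distrib_left c_def mult_ac)
  qed
  have uniq: "d j = \<tau> * poly (pderiv (L j)) (grid \<tau> k)" if "bdf_exact \<tau> k p d" "j \<in> ?A" for d j
  proof -
    have "\<tau> * poly (pderiv (L j)) (grid \<tau> k) = (\<Sum>i\<in>?A. d i * poly (L j) (grid \<tau> i))"
      using that L_deg unfolding bdf_exact_def by blast
    also have "\<dots> = (\<Sum>i\<in>?A. if i = j then d i else 0)"
      by (rule sum.cong) (use L_val that in auto)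
    also have "\<dots> = d j" using that by simp
    finally show ?thesis by simp
  qed
  show ?thesis
  proof (rule ex1I[where a = c])
    show "bdf_exact \<tau> k p c \<and> (\<forall>j. j \<notin> ?A \<longrightarrow> c j = 0)" using c by (auto simp: c_def)
  next
    fix d assume "bdf_exact \<tau> k p d \<and> (\<forall>j. j \<notin> ?A \<longrightarrow> d j = 0)"
    then show "d = c" using uniq by (auto simp: c_def fun_eq_iff)
  qed
qed

text \<open>A method is represented by the relation between a right-hand side \<open>f\<close> and the infinite
  sequences it can produce. The coefficients refer to the stencil ending at \<open>k\<close> and are
  reused unchanged at every later grid point \<open>m\<close>.\<close>

definition bdf_method ::
    "real \<Rightarrow> nat \<Rightarrow> nat \<Rightarrow> (real \<Rightarrow> real^'n \<Rightarrow> real^'n) \<Rightarrow> (nat \<Rightarrow> real^'n) \<Rightarrow> bool" where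
  "bdf_method \<tau> k p f y \<longleftrightarrow>
     (\<forall>m\<ge>p. (\<Sum>i=0..p. bdf_coeff \<tau> k p (k-i) *\<^sub>R y (m-i)) = \<tau> *\<^sub>R f (grid \<tau> m) (y m))"

definition bdf_residual ::
    "real \<Rightarrow> nat \<Rightarrow> nat \<Rightarrow> (real \<Rightarrow> real^'n \<Rightarrow> real^'n) \<Rightarrow> (nat \<Rightarrow> real^'n) \<Rightarrow> nat \<Rightarrow> real^'n \<Rightarrow> real^'n" where
  "bdf_residual \<tau> k p f y m x =
     \<tau> *\<^sub>R f (grid \<tau> m) x
       - (bdf_coeff \<tau> k p k *\<^sub>R x + (\<Sum>i=1..p. bdf_coeff \<tau> k p (k-i) *\<^sub>R y (m-i)))"

definition mrms_space ::
    "real \<Rightarrow> nat \<Rightarrow> (real \<Rightarrow> real^'n \<Rightarrow> real^'n) \<Rightarrow> (nat \<Rightarrow> real^'n) \<Rightarrow> nat \<Rightarrow> (real^'n) set" where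
  "mrms_space \<tau> k f y m =
     span (y ` {m-k..<m} \<union> (\<lambda>j. \<tau> *\<^sub>R f (grid \<tau> j) (y j)) ` {m-k..<m})"

text \<open>A minimizer need not exist or be unique for general \<open>f\<close> and \<open>N\<close>; every choice of
  minimizers counts as a sequence produced by the method.\<close>

definition mrms_method ::
    "(real^'n \<Rightarrow> real) \<Rightarrow> real \<Rightarrow> nat \<Rightarrow> nat \<Rightarrow>
     (real \<Rightarrow> real^'n \<Rightarrow> real^'n) \<Rightarrow> (nat \<Rightarrow> real^'n) \<Rightarrow> bool" where
  "mrms_method N \<tau> k p f y \<longleftrightarrow>
     (\<forall>m\<ge>k. is_arg_min (\<lambda>x. N (bdf_residual \<tau> k p f y m x)) (\<lambda>x. x \<in> mrms_space \<tau> k f y m) (y m))"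

text \<open>The parameter \<open>s\<close> is the number of starting values of the method \<open>M\<close>.\<close>

definition zero_stable ::
    "(real^'n \<Rightarrow> real) \<Rightarrow> nat \<Rightarrow>
     ((real \<Rightarrow> real^'n \<Rightarrow> real^'n) \<Rightarrow> (nat \<Rightarrow> real^'n) \<Rightarrow> bool) \<Rightarrow> bool" where
  "zero_stable N s M \<longleftrightarrow>
     (\<exists>C. \<forall>y. M (\<lambda>t x. 0) y \<longrightarrow> (\<forall>m. N (y m) \<le> C * (MAX j\<in>{..<s}. N (y j))))"

end

theory Submission
  imports Defs
begin

text \<open>
  For \<open>f \<equiv> 0\<close> the residual is affine in \<open>x\<close> with leading coefficient \<open>-c\<^sub>k\<close>, and its zero
  is a linear combination of the last \<open>p \<le> k\<close> values, so it lies in the search space \<open>\<V>\<close>. As soon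
  as \<open>c\<^sub>k \<noteq> 0\<close> the minimal residual is therefore \<open>0\<close>, whatever the norm, and a minimizer is
  nothing but a BDF step (\<open>mrms_zero_step\<close>).

  That \<open>c\<^sub>k \<noteq> 0\<close> is read off from exactness on \<open>q(x) = (x - t\<^bsub>k-p\<^esub>) \<cdots> (x - t\<^bsub>k-1\<^esub>)\<close>, which has
  degree \<open>p\<close>: only the node \<open>t\<^sub>k\<close> contributes, so \<open>c\<^sub>k q(t\<^sub>k) = \<tau> q'(t\<^sub>k)\<close>, and a monic polynomial
  all of whose roots are real has positive slope to the right of them (\<open>bdf_coeff_leading_nonzero\<close>).

  An MRMS sequence is bound by the BDF recurrence only from index \<open>k\<close> on, whereas a BDF sequence
  obeys it from index \<open>p\<close> on. Dropping the first \<open>k - p\<close> values aligns the two: the shifted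
  sequence is a BDF sequence whose starting values are the last \<open>p\<close> of the \<open>k\<close> starting values
  of the MRMS method. The BDF stability bound then carries over, with the constant enlarged to at
  least \<open>1\<close> to cover the starting values themselves.
\<close>

lemma pderiv_prod_linear_pos:
  fixes a :: "'b \<Rightarrow> real"
  assumes "finite A" "A \<noteq> {}" "\<And>i. i \<in> A \<Longrightarrow> a i < x"
  shows "0 < poly (pderiv (\<Prod>i\<in>A. [:- a i, 1:])) x"
proof -
  have "poly (pderiv (\<Prod>i\<in>A. [:- a i, 1:])) x = (\<Sum>j\<in>A. \<Prod>i\<in>A - {j}. x - a i)"
    by (simp add: pderiv_prod poly_sum poly_prod pderiv_pCons)
  also have "\<dots> > 0"
    by (intro sum_pos prod_pos) (use assms in auto)
  finally show ?thesis .
qed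

lemma bdf_exact_bdf_coeff:
  assumes "\<tau> > 0" "p \<le> k"
  shows "bdf_exact \<tau> k p (bdf_coeff \<tau> k p)"
  using theI'[OF bdf_coeff_unique[OF assms]] unfolding bdf_coeff_def by blast

text \<open>The test polynomial has its roots at all stencil nodes except the last, which isolates the
  leading coefficient. The condition \<open>1 \<le> p\<close> gives it a root at all; for \<open>p = 0\<close>, exactness on
  constants makes the only coefficient \<open>0\<close>.\<close>

lemma bdf_coeff_leading_nonzero:
  assumes "\<tau> > 0" "1 \<le> p" "p \<le> k"
  shows "bdf_coeff \<tau> k p k \<noteq> 0"
proof
  assume zero: "bdf_coeff \<tau> k p k = 0"
  define q where "q = (\<Prod>i\<in>{k-p..<k}. [:- grid \<tau> i, 1:])"
  have "degree q \<le> (\<Sum>i\<in>{k-p..<k}. degree [:- grid \<tau> i, 1:])"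
    unfolding q_def by (rule order_trans[OF degree_prod_sum_le]) (auto simp: o_def)
  also have "\<dots> = p" using assms by simp
  finally have "\<tau> * poly (pderiv q) (grid \<tau> k)
      = (\<Sum>j=k-p..k. bdf_coeff \<tau> k p j * poly q (grid \<tau> j))"
    using bdf_exact_bdf_coeff[OF assms(1,3)] unfolding bdf_exact_def by blast
  also have "\<dots> = 0"
  proof (rule sum.neutral, rule ballI)
    fix j assume j: "j \<in> {k-p..k}"
    show "bdf_coeff \<tau> k p j * poly q (grid \<tau> j) = 0"
    proof (cases "j = k")
      case False
      with j have "j \<in> {k-p..<k}" by auto
      then have "poly q (grid \<tau> j) = 0"
        unfolding q_def poly_prod by (intro prod_zero) auto
      then show ?thesis by simp
    qed (simp add: zero)
  qed
  finally have "\<tau> * poly (pderiv q) (grid \<tau> k) = 0" .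
  moreover have "0 < poly (pderiv q) (grid \<tau> k)"
    unfolding q_def by (rule pderiv_prod_linear_pos) (use assms in auto)
  ultimately show False using assms(1) by simp
qed

text \<open>The exact BDF value is a competitor with residual \<open>0\<close>, so definiteness of the norm forces
  the residual of every minimizer to vanish.\<close>

lemma mrms_zero_step:
  fixes N :: "real^'n \<Rightarrow> real" and y :: "nat \<Rightarrow> real^'n"
  assumes "is_norm N" "bdf_coeff \<tau> k p k \<noteq> 0" "p \<le> k"
    and "mrms_method N \<tau> k p (\<lambda>t x. 0) y" "k \<le> m"
  shows "(\<Sum>i=0..p. bdf_coeff \<tau> k p (k-i) *\<^sub>R y (m-i)) = 0"
proof -
  define c where "c = bdf_coeff \<tau> k p"
  define b where "b = (\<Sum>i=1..p. c (k-i) *\<^sub>R y (m-i))"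
  let ?r = "bdf_residual \<tau> k p (\<lambda>t x. 0) y m"
  let ?V = "mrms_space \<tau> k (\<lambda>t x. 0) y m"
  have r: "?r x = - (c k *\<^sub>R x + b)" for x
    by (simp add: bdf_residual_def c_def b_def)
  have N0: "N 0 = 0" and N_nonneg: "0 \<le> N x" and N_zeroD: "N x = 0 \<Longrightarrow> x = 0" for x
    using assms(1) unfolding is_norm_def by blast+
  define x where "x = (- (1 / c k)) *\<^sub>R b"
  have "b \<in> ?V"
    unfolding b_def mrms_space_def
  proof (intro span_sum span_scale span_base UnI1 imageI)
    show "m - i \<in> {m-k..<m}" if "i \<in> {1..p}" for i
      using that assms(3,5) by auto
  qed
  then have "x \<in> ?V"
    unfolding x_def mrms_space_def by (rule span_scale)
  moreover have "is_arg_min (\<lambda>x. N (?r x)) (\<lambda>x. x \<in> ?V) (y m)"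
    using assms(4,5) by (simp add: mrms_method_def)
  ultimately have "\<not> N (?r x) < N (?r (y m))"
    unfolding is_arg_min_def by blast
  moreover have "?r x = 0"
    using assms(2) by (simp add: r x_def c_def)
  ultimately have "N (?r (y m)) \<le> 0"
    by (simp add: N0)
  then have "?r (y m) = 0"
    using N_nonneg N_zeroD by (meson order_antisym)
  moreover have "(\<Sum>i=0..p. c (k-i) *\<^sub>R y (m-i)) = c k *\<^sub>R y m + b"
    unfolding b_def by (simp add: sum.atLeast_Suc_atMost)
  ultimately show ?thesis
    unfolding r c_def by (metis neg_equal_0_iff_equal)
qed

lemma mrms_zero_shift_bdf:
  fixes N :: "real^'n \<Rightarrow> real" and y :: "nat \<Rightarrow> real^'n"
  assumes "is_norm N" "\<tau> > 0" "1 \<le> p" "p \<le> k"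
    and "mrms_method N \<tau> k p (\<lambda>t x. 0) y"
  shows "bdf_method \<tau> k p (\<lambda>t x. 0) (\<lambda>m. y (m + (k - p)))"
  unfolding bdf_method_def
proof (intro allI impI)
  fix m assume m: "p \<le> m"
  have "(\<Sum>i=0..p. bdf_coeff \<tau> k p (k-i) *\<^sub>R y (m - i + (k - p)))
      = (\<Sum>i=0..p. bdf_coeff \<tau> k p (k-i) *\<^sub>R y (m + (k - p) - i))"
    using m by (intro sum.cong) auto
  also have "\<dots> = 0"
    by (rule mrms_zero_step[OF assms(1) bdf_coeff_leading_nonzero[OF assms(2-4)] assms(4,5)])
      (use m assms(4) in simp)
  finally show "(\<Sum>i=0..p. bdf_coeff \<tau> k p (k-i) *\<^sub>R y (m - i + (k - p))) = \<tau> *\<^sub>R 0"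
    by simp
qed

theorem lemma1:
  fixes N :: "real^'n \<Rightarrow> real" and \<tau> :: real and k p :: nat
  assumes "is_norm N"
    and "\<tau> > 0"
    and "1 \<le> p" and "p \<le> k"
    and "zero_stable N p (bdf_method \<tau> k p)"
  shows "zero_stable N k (mrms_method N \<tau> k p)"
proof -
  obtain C where C: "N (z m) \<le> C * (MAX j\<in>{..<p}. N (z j))"
    if "bdf_method \<tau> k p (\<lambda>t x. 0) z" for z m
    using assms(5) unfolding zero_stable_def by blast
  show ?thesis
    unfolding zero_stable_def
  proof (intro exI[of _ "max C 1"] allI impI)
    fix y m assume y: "mrms_method N \<tau> k p (\<lambda>t x. 0) y"
    define M where "M = (MAX j\<in>{..<k}. N (y j))"
    have start: "N (y j) \<le> M" if "j < k" for j
      unfolding M_def using that by (intro Max_ge) auto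
    have nonneg: "0 \<le> N x" for x
      using assms(1) by (simp add: is_norm_def)
    have "0 \<le> M"
      using nonneg[of "y 0"] start[of 0] assms(3,4) by linarith
    show "N (y m) \<le> max C 1 * (MAX j\<in>{..<k}. N (y j))"
      unfolding M_def[symmetric]
    proof (cases "m < k")
      case True
      have "1 * M \<le> max C 1 * M"
        using \<open>0 \<le> M\<close> by (intro mult_right_mono) auto
      with start[OF True] show "N (y m) \<le> max C 1 * M" by simp
    next
      case False
      define M' where "M' = (MAX j\<in>{..<p}. N (y (j + (k - p))))"
      have "M' \<in> (\<lambda>j. N (y (j + (k - p)))) ` {..<p}"
        unfolding M'_def using assms(3) by (intro Max_in) (auto simp: lessThan_empty_iff)
      then have M': "0 \<le> M'" "M' \<le> M"
        using start nonneg assms(4) by auto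
      have "N (y (m - (k - p) + (k - p))) \<le> C * M'"
        unfolding M'_def by (rule C[OF mrms_zero_shift_bdf[OF assms(1-4) y]])
      then have "N (y m) \<le> C * M'"
        using False by simp
      also have "\<dots> \<le> max C 1 * M"
        using M' by (intro mult_mono) auto
      finally show "N (y m) \<le> max C 1 * M" .
    qed
  qed
qed

end
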